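(* Let $\lambda>0$. Assume there are no arbitrages, meaning: for every $b\in\mathbf{R}^n$ with $\mu^Tb>0$, $\mathbf 1^Tb=1$ and $b\ge 0$, one has $b^T\Sigma b>0$. Then every solution $b^{\mathrm{qp}}$ of the quadratic problem (QRCK) $$\begin{array}{ll}\text{maximize}&\mathbf{E}\,\rho^Tb-\frac12\mathbf{E}(\rho^Tb)^2\\ \text{subject to}&\mathbf 1^Tb=1,\quad b\ge0,\\ &-\lambda\,\mathbf{E}\,\rho^Tb+\frac{\lambda(\lambda+1)}{2}\mathbf{E}(\rho^Tb)^2\le 0,\end{array}$$ with variable $b\in\mathbf{R}^n$, is a Markowitz portfolio; that is, there exists $\gamma\ge0$ such that $b^{\mathrm{qp}}$ is a solution of $$\begin{array}{ll}\text{maximize}&\mu^Tb-\frac{\gamma}{2}b^T\Sigma b\\ \text{subject to}&\mathbf 1^Tb=1,\quad b\ge0.\end{array}$$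
   Context: $r$ is a random vector in $\mathbf{R}^n$ with nonnegative entries and $r_n=1$ almost surely, with finite first and second moments. $\mathbf 1$ is the all-ones vector and $b\ge0$ is entrywise. $\rho=r-\mathbf 1$ is the excess return (so $\rho_n=0$ almost surely), $\mu=\mathbf{E}\rho$ is its mean, and $\Sigma=\mathbf{E}\rho\rho^T-\mu\mu^T$ is its covariance matrix. *)

theory Defs
  imports "HOL-Probability.Probability"
begin

text \<open>Return vectors are functions \<^term>\<open>r :: 'a \<Rightarrow> real ^ 'n\<close> on a probability space
  with sample space in \<^typ>\<open>'a\<close>; the order on \<^typ>\<open>real ^ 'n\<close> is the componentwise one.\<close>

definition excess_return :: "('a \<Rightarrow> real ^ 'n) \<Rightarrow> 'a \<Rightarrow> real ^ 'n" where
  "excess_return r \<omega> = r \<omega> - vec 1"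

definition mean_return :: "'a measure \<Rightarrow> ('a \<Rightarrow> real ^ 'n) \<Rightarrow> real ^ 'n" where
  "mean_return M \<rho> = (LINT \<omega>|M. \<rho> \<omega>)"

definition outer_product :: "real ^ 'n \<Rightarrow> real ^ 'n \<Rightarrow> real ^ 'n ^ 'n" where
  "outer_product x y = (\<chi> i j. x $ i * y $ j)"

definition covariance_matrix :: "'a measure \<Rightarrow> ('a \<Rightarrow> real ^ 'n) \<Rightarrow> real ^ 'n ^ 'n" where
  "covariance_matrix M \<rho> =
     (LINT \<omega>|M. outer_product (\<rho> \<omega>) (\<rho> \<omega>))
       - outer_product (mean_return M \<rho>) (mean_return M \<rho>)"

definition portfolio :: "real ^ 'n \<Rightarrow> bool" where
  "portfolio b \<longleftrightarrow> vec 1 \<bullet> b = 1 \<and> 0 \<le> b"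

definition no_arbitrage :: "real ^ 'n \<Rightarrow> real ^ 'n ^ 'n \<Rightarrow> bool" where
  "no_arbitrage \<mu> \<Sigma> \<longleftrightarrow>
     (\<forall>b. \<mu> \<bullet> b > 0 \<and> portfolio b \<longrightarrow> b \<bullet> (\<Sigma> *v b) > 0)"

definition qrck_objective :: "'a measure \<Rightarrow> ('a \<Rightarrow> real ^ 'n) \<Rightarrow> real ^ 'n \<Rightarrow> real" where
  "qrck_objective M \<rho> b =
     (LINT \<omega>|M. \<rho> \<omega> \<bullet> b) - 1 / 2 * (LINT \<omega>|M. (\<rho> \<omega> \<bullet> b)\<^sup>2)"

definition qrck_feasible :: "'a measure \<Rightarrow> ('a \<Rightarrow> real ^ 'n) \<Rightarrow> real \<Rightarrow> real ^ 'n \<Rightarrow> bool" where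
  "qrck_feasible M \<rho> l b \<longleftrightarrow> portfolio b \<and>
     - l * (LINT \<omega>|M. \<rho> \<omega> \<bullet> b)
       + l * (l + 1) / 2 * (LINT \<omega>|M. (\<rho> \<omega> \<bullet> b)\<^sup>2) \<le> 0"

definition qrck_solution :: "'a measure \<Rightarrow> ('a \<Rightarrow> real ^ 'n) \<Rightarrow> real \<Rightarrow> real ^ 'n \<Rightarrow> bool" where
  "qrck_solution M \<rho> l b \<longleftrightarrow> is_arg_max (qrck_objective M \<rho>) (qrck_feasible M \<rho> l) b"

definition markowitz_portfolio :: "real ^ 'n \<Rightarrow> real ^ 'n ^ 'n \<Rightarrow> real ^ 'n \<Rightarrow> bool" where
  "markowitz_portfolio \<mu> \<Sigma> b \<longleftrightarrow>
     (\<exists>\<gamma>\<ge>0. is_arg_max (\<lambda>c. \<mu> \<bullet> c - \<gamma> / 2 * (c \<bullet> (\<Sigma> *v c))) portfolio b)"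

end

theory Submission
  imports Defs
begin

text \<open>
  Mean and variance of a portfolio determine both the QRCK objective and the QRCK constraint, and
  at a fixed mean both improve when the variance decreases. Hence no portfolio \<open>c\<close> has larger mean
  and smaller variance than a QRCK solution \<open>b\<close>: diluting \<open>c\<close> with the riskless asset to the mean
  of \<open>b\<close> would give a feasible point with a better objective. So the convex set of pairs
  (mean, upper bound on the variance) can be separated in the plane from the open quadrant at the
  point of \<open>b\<close>. The separating line is not vertical, since the riskless asset gives the pair
  \<open>(0, 0)\<close> while \<open>b\<close> has positive variance by absence of arbitrage; its slope gives \<open>\<gamma>\<close>.
\<close>

section \<open>Quadratic forms and portfolios\<close>

text \<open>As \<open>s - s * t = s * s\<close> and \<open>t - s * t = t * t\<close>, the last term
  corrects the pure terms and supplies both cross terms. Its sign then decides convexity.\<close>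

lemma quadratic_form_convex_combination:
  fixes A :: "real ^ 'n ^ 'n"
  assumes "s + t = 1"
  shows "(s *\<^sub>R x + t *\<^sub>R y) \<bullet> (A *v (s *\<^sub>R x + t *\<^sub>R y)) =
    s * (x \<bullet> (A *v x)) + t * (y \<bullet> (A *v y)) - s * t * ((x - y) \<bullet> (A *v (x - y)))"
proof -
  have t: "t = 1 - s" using assms by simp
  show ?thesis
    unfolding t
    by (simp add: matrix_vector_right_distrib matrix_vector_mult_diff_distrib
        matrix_vector_mult_scaleR inner_add_left inner_add_right inner_diff_left inner_diff_right
        algebra_simps)
qed

lemma quadratic_form_convex:
  fixes A :: "real ^ 'n ^ 'n"
  assumes "\<And>x. 0 \<le> x \<bullet> (A *v x)" "0 \<le> s" "0 \<le> t" "s + t = 1"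
  shows "(s *\<^sub>R x + t *\<^sub>R y) \<bullet> (A *v (s *\<^sub>R x + t *\<^sub>R y)) \<le>
    s * (x \<bullet> (A *v x)) + t * (y \<bullet> (A *v y))"
  using quadratic_form_convex_combination[OF assms(4), of x y A] assms(1)[of "x - y"] assms(2,3)
  by simp

lemma portfolio_convex_combination:
  assumes "portfolio x" "portfolio y" "0 \<le> s" "0 \<le> t" "s + t = 1"
  shows "portfolio (s *\<^sub>R x + t *\<^sub>R y)"
  using assms by (auto simp: portfolio_def inner_add_right less_eq_vec_def)

lemma portfolio_axis: "portfolio (axis k 1)"
  unfolding portfolio_def inner_axis by (auto simp: less_eq_vec_def axis_def)

text \<open>The mean is linear, but convexity of the variance only yields upper bounds: pairs with
  the exact variance need not form a convex set.\<close>

lemma convex_mean_variance_epigraph: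
  fixes \<Sigma> :: "real ^ 'n ^ 'n"
  assumes "\<And>x. 0 \<le> x \<bullet> (\<Sigma> *v x)"
  shows "convex {(m, s). \<exists>c. portfolio c \<and> \<mu> \<bullet> c = m \<and> c \<bullet> (\<Sigma> *v c) \<le> s}"
proof (rule convexI, clarsimp)
  fix c1 c2 :: "real ^ 'n" and s1 s2 u v :: real
  assume c: "portfolio c1" "portfolio c2"
    and s: "c1 \<bullet> (\<Sigma> *v c1) \<le> s1" "c2 \<bullet> (\<Sigma> *v c2) \<le> s2"
    and uv: "0 \<le> u" "0 \<le> v" "u + v = 1"
  have "(u *\<^sub>R c1 + v *\<^sub>R c2) \<bullet> (\<Sigma> *v (u *\<^sub>R c1 + v *\<^sub>R c2)) \<le> u * s1 + v * s2"
    using quadratic_form_convex[OF assms uv, of c1 c2] mult_left_mono[OF s(1) uv(1)]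
      mult_left_mono[OF s(2) uv(2)]
    by linarith
  with portfolio_convex_combination[OF c uv]
  show "\<exists>c. portfolio c \<and> \<mu> \<bullet> c = u * (\<mu> \<bullet> c1) + v * (\<mu> \<bullet> c2) \<and>
      c \<bullet> (\<Sigma> *v c) \<le> u * s1 + v * s2"
    by (intro exI[of _ "u *\<^sub>R c1 + v *\<^sub>R c2"]) (simp add: inner_add_right)
qed

section \<open>Mean-variance optimality\<close>

lemma markowitz_portfolio_if_not_dominated:
  fixes \<Sigma> :: "real ^ 'n ^ 'n"
  assumes psd: "\<And>x. 0 \<le> x \<bullet> (\<Sigma> *v x)"
    and e: "portfolio e" "\<mu> \<bullet> e = 0" "e \<bullet> (\<Sigma> *v e) = 0"
    and b: "portfolio b" "0 < b \<bullet> (\<Sigma> *v b)"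
    and undominated: "\<And>c. portfolio c \<Longrightarrow> \<mu> \<bullet> b < \<mu> \<bullet> c \<Longrightarrow> b \<bullet> (\<Sigma> *v b) \<le> c \<bullet> (\<Sigma> *v c)"
  shows "markowitz_portfolio \<mu> \<Sigma> b"
proof -
  define A where "A = {(m, s). \<exists>c. portfolio c \<and> \<mu> \<bullet> c = m \<and> c \<bullet> (\<Sigma> *v c) \<le> s}"
  define m v where "m = \<mu> \<bullet> b" and "v = b \<bullet> (\<Sigma> *v b)"
  define T where "T = {m<..} \<times> {..<v}"
  have "convex A"
    unfolding A_def by (rule convex_mean_variance_epigraph[OF psd])
  moreover have "convex T"
    unfolding T_def by (intro convex_Times convex_real_interval)
  moreover have "(m, v) \<in> A"
    unfolding A_def m_def v_def using b by blast
  moreover have "(m + 1, v - 1) \<in> T"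
    by (simp add: T_def)
  \<comment> \<open>A common pair would come from a portfolio with mean above \<open>m\<close> and
    variance below \<open>v\<close>, which \<open>undominated\<close> forbids.\<close>
  moreover have "A \<inter> T = {}"
    using undominated by (fastforce simp: A_def T_def m_def v_def)
  ultimately obtain a \<beta> where a0: "a \<noteq> 0"
    and A: "\<And>x. x \<in> A \<Longrightarrow> a \<bullet> x \<le> \<beta>" and T: "\<And>x. x \<in> T \<Longrightarrow> \<beta> \<le> a \<bullet> x"
    using separating_hyperplane_sets[of A T] by blast
  obtain p q where a: "a = (p, q)"
    by (cases a)
  have A': "p * (\<mu> \<bullet> c) + q * (c \<bullet> (\<Sigma> *v c)) \<le> \<beta>" if "portfolio c" for c
    using A[of "(\<mu> \<bullet> c, c \<bullet> (\<Sigma> *v c))"] that by (auto simp: A_def a)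
  have T': "\<beta> \<le> p * (m + x) + q * (v - y)" if "0 < x" "0 < y" for x y
    using T[of "(m + x, v - y)"] that by (simp add: T_def a)
  \<comment> \<open>Comparing the quadrant with the point of \<open>b\<close> eliminates
    \<open>\<beta>\<close>. Making \<open>x\<close> or \<open>y\<close> large then fixes the signs
    of \<open>p\<close> and \<open>q\<close>.\<close>
  have lower: "0 \<le> p * x - q * y" if "0 < x" "0 < y" for x y
    using T'[OF that] A'[OF b(1)] by (simp add: m_def v_def algebra_simps)
  have p: "0 \<le> p"
  proof (rule ccontr)
    assume "\<not> 0 \<le> p"
    then have "0 < (1 + \<bar>q\<bar>) / - p" "p * ((1 + \<bar>q\<bar>) / - p) = - (1 + \<bar>q\<bar>)"
      by (simp_all add: divide_pos_neg)
    with lower[of "(1 + \<bar>q\<bar>) / - p" 1] show False by linarith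
  qed
  have q: "q \<le> 0"
  proof (rule ccontr)
    assume "\<not> q \<le> 0"
    then have "0 < (1 + \<bar>p\<bar>) / q" "q * ((1 + \<bar>p\<bar>) / q) = 1 + \<bar>p\<bar>"
      by simp_all
    with lower[of 1 "(1 + \<bar>p\<bar>) / q"] show False by linarith
  qed
  have upper: "\<beta> \<le> p * m + q * v"
  proof (rule field_le_epsilon)
    fix \<epsilon> :: real assume \<epsilon>: "0 < \<epsilon>"
    \<comment> \<open>The corner \<open>(m, v)\<close> lies only in the closure of \<open>T\<close>,
      so it is approached diagonally. The 1 keeps the denominator positive, given
      \<open>0 \<le> p - q\<close>.\<close>
    define \<delta> where "\<delta> = \<epsilon> / (p - q + 1)"
    have "0 < \<delta>" "\<delta> * (p - q) \<le> \<epsilon>"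
      using p q \<epsilon> by (auto simp: \<delta>_def field_simps)
    with T'[of \<delta> \<delta>] show "\<beta> \<le> p * m + q * v + \<epsilon>"
      by (simp add: algebra_simps)
  qed
  \<comment> \<open>Otherwise the functional sees only the variance: \<open>e\<close> forces
    \<open>0 \<le> \<beta>\<close>, while \<open>upper\<close> gives
    \<open>\<beta> \<le> q * v < 0\<close>.\<close>
  have "p \<noteq> 0"
  proof
    assume "p = 0"
    then have "q < 0" using q a0 by (simp add: a zero_prod_def)
    then have "q * v < 0" using b(2) by (simp add: v_def mult_neg_pos)
    moreover have "0 \<le> \<beta>" using A'[OF e(1)] e(2,3) by simp
    ultimately show False using upper \<open>p = 0\<close> by simp
  qed
  with p have p0: "0 < p" by simp
  \<comment> \<open>Dividing the functional by \<open>p\<close> turns it into mean minus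
    \<open>\<gamma> / 2\<close> times variance.\<close>
  define \<gamma> where "\<gamma> = - 2 * q / p"
  have "0 \<le> \<gamma>" using p0 q by (simp add: \<gamma>_def divide_nonpos_pos)
  moreover have "\<mu> \<bullet> c - \<gamma> / 2 * (c \<bullet> (\<Sigma> *v c)) \<le> \<mu> \<bullet> b - \<gamma> / 2 * (b \<bullet> (\<Sigma> *v b))"
    if "portfolio c" for c
  proof -
    have "p * (\<mu> \<bullet> c) + q * (c \<bullet> (\<Sigma> *v c)) \<le> p * m + q * v"
      using A'[OF that] upper by simp
    then have "(p * (\<mu> \<bullet> c) + q * (c \<bullet> (\<Sigma> *v c))) / p \<le> (p * m + q * v) / p"
      using p0 by (simp add: divide_right_mono)
    then show ?thesis
      using p0 by (simp add: \<gamma>_def m_def v_def add_divide_distrib)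
  qed
  ultimately show ?thesis
    unfolding markowitz_portfolio_def is_arg_max_linorder using b(1) by blast
qed

text \<open>The problem in terms of \<open>\<mu>\<close> and \<open>\<Sigma>\<close> alone:
  \<open>K\<close> is the second moment, variance plus squared mean. The assumption
  \<open>dilute\<close> encodes that \<open>e\<close> contributes neither variance nor
  covariance.\<close>

lemma markowitz_portfolio_if_mean_variance_qrck_optimal:
  fixes \<Sigma> :: "real ^ 'n ^ 'n" and \<mu> :: "real ^ 'n"
  defines "K \<equiv> \<lambda>c. c \<bullet> (\<Sigma> *v c) + (\<mu> \<bullet> c)\<^sup>2"
  assumes psd: "\<And>x. 0 \<le> x \<bullet> (\<Sigma> *v x)"
    and e: "portfolio e" "\<mu> \<bullet> e = 0"
    and dilute: "\<And>s t c. (s *\<^sub>R c + t *\<^sub>R e) \<bullet> (\<Sigma> *v (s *\<^sub>R c + t *\<^sub>R e)) = s\<^sup>2 * (c \<bullet> (\<Sigma> *v c))"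
    and l: "0 < l"
    and no_arb: "no_arbitrage \<mu> \<Sigma>"
    and opt: "is_arg_max (\<lambda>c. \<mu> \<bullet> c - 1 / 2 * K c)
      (\<lambda>c. portfolio c \<and> - l * (\<mu> \<bullet> c) + l * (l + 1) / 2 * K c \<le> 0) b"
  shows "markowitz_portfolio \<mu> \<Sigma> b"
proof (cases "\<exists>c. portfolio c \<and> 0 < \<mu> \<bullet> c")
  \<comment> \<open>The constraint forces the mean of \<open>b\<close> to be nonnegative. If no mean
    is positive, \<open>b\<close> thus maximizes the mean, and \<open>\<gamma> = 0\<close>
    works.\<close>
  case False
  have b: "portfolio b" "- l * (\<mu> \<bullet> b) + l * (l + 1) / 2 * K b \<le> 0"
    using opt by (simp_all add: is_arg_max_def)
  have "0 \<le> l * (l + 1) / 2 * K b"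
    using l psd[of b] by (simp add: K_def)
  with b have "0 \<le> l * (\<mu> \<bullet> b)" by linarith
  with l have "0 \<le> \<mu> \<bullet> b" by (simp add: zero_le_mult_iff)
  then have "is_arg_max (\<lambda>c. \<mu> \<bullet> c - 0 / 2 * (c \<bullet> (\<Sigma> *v c))) portfolio b"
    unfolding is_arg_max_linorder using False b(1) by force
  then show ?thesis unfolding markowitz_portfolio_def by blast
next
  case True
  then obtain c where c: "portfolio c" "0 < \<mu> \<bullet> c" by blast
  have b: "portfolio b" "- l * (\<mu> \<bullet> b) + l * (l + 1) / 2 * K b \<le> 0"
    using opt by (simp_all add: is_arg_max_def)
  have best: "\<mu> \<bullet> x - 1 / 2 * K x \<le> \<mu> \<bullet> b - 1 / 2 * K b"
    if "portfolio x" "- l * (\<mu> \<bullet> x) + l * (l + 1) / 2 * K x \<le> 0" for x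
    using opt that by (simp add: is_arg_max_linorder)
  have K_nonneg: "0 \<le> K x" for x
    using psd[of x] by (simp add: K_def)
  have K_dilute: "K (t *\<^sub>R x + (1 - t) *\<^sub>R e) = t\<^sup>2 * K x" for t x
    unfolding K_def dilute using e(2) by (simp add: inner_add_right power_mult_distrib distrib_left)
  have mean_pos: "0 < \<mu> \<bullet> b"
  proof -
    \<comment> \<open>Dilution scales the mean by \<open>t\<close> but \<open>K\<close> by its
      square, so a small \<open>t\<close> gives a feasible point with positive objective. The extra
      \<open>\<mu> \<bullet> c\<close> in the denominator makes \<open>tK\<close> strict, ensures
      \<open>t \<le> 1\<close> and covers \<open>K c = 0\<close>.\<close>
    define t where "t = (\<mu> \<bullet> c) / ((l + 1) * K c + \<mu> \<bullet> c)"
    define x where "x = t *\<^sub>R c + (1 - t) *\<^sub>R e"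
    have D: "0 < (l + 1) * K c + \<mu> \<bullet> c"
      using K_nonneg[of c] l c(2) by (simp add: add_nonneg_pos)
    have t: "0 < t" "t \<le> 1"
      using D c(2) K_nonneg[of c] l by (auto simp: t_def)
    have "t * ((l + 1) * K c + \<mu> \<bullet> c) = \<mu> \<bullet> c"
      using D by (simp add: t_def)
    then have "t * ((l + 1) * K c) = \<mu> \<bullet> c - t * (\<mu> \<bullet> c)"
      by (simp add: algebra_simps)
    moreover have "0 < t * (\<mu> \<bullet> c)" using t(1) c(2) by simp
    ultimately have tK: "t * ((l + 1) * K c) < \<mu> \<bullet> c" by linarith
    have x: "\<mu> \<bullet> x = t * (\<mu> \<bullet> c)" "K x = t\<^sup>2 * K c"
      using e(2) K_dilute[of t c] by (simp_all add: x_def inner_add_right)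
    have "(l + 1) * K x = t * (t * ((l + 1) * K c))"
      by (simp add: x(2) power2_eq_square)
    also have "\<dots> < t * (\<mu> \<bullet> c)"
      using tK t(1) by (rule mult_strict_left_mono)
    finally have lK: "(l + 1) * K x < \<mu> \<bullet> x"
      using x(1) by simp
    have "l * ((l + 1) * K x) < l * (\<mu> \<bullet> x)"
      using lK l by simp
    moreover have "0 \<le> l * (l + 1) * K x" using l K_nonneg[of x] by simp
    ultimately have "- l * (\<mu> \<bullet> x) + l * (l + 1) / 2 * K x \<le> 0"
      by (simp add: mult.assoc)
    moreover have "portfolio x"
      unfolding x_def using t by (intro portfolio_convex_combination c e) auto
    ultimately have "\<mu> \<bullet> x - 1 / 2 * K x \<le> \<mu> \<bullet> b - 1 / 2 * K b"
      using best by blast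
    moreover have "K x \<le> (l + 1) * K x"
      using l K_nonneg[of x] by (simp add: algebra_simps)
    \<comment> \<open>The objective is positive at \<open>x\<close>, hence at \<open>b\<close>,
      where it is at most the mean.\<close>
    ultimately show ?thesis using lK K_nonneg[of x] K_nonneg[of b] by linarith
  qed
  show ?thesis
  proof (rule markowitz_portfolio_if_not_dominated[OF psd e _ b(1)])
    show "e \<bullet> (\<Sigma> *v e) = 0" using dilute[of 0 0 1] by simp
    show "0 < b \<bullet> (\<Sigma> *v b)"
      using no_arb b(1) mean_pos by (simp add: no_arbitrage_def)
    fix x assume x: "portfolio x" "\<mu> \<bullet> b < \<mu> \<bullet> x"
    show "b \<bullet> (\<Sigma> *v b) \<le> x \<bullet> (\<Sigma> *v x)"
    proof (rule ccontr)
      assume less: "\<not> ?thesis"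
      \<comment> \<open>This ratio gives \<open>y\<close> the mean of \<open>b\<close>. It is at
        most 1, so dilution does not raise the variance.\<close>
      define t where "t = (\<mu> \<bullet> b) / (\<mu> \<bullet> x)"
      define y where "y = t *\<^sub>R x + (1 - t) *\<^sub>R e"
      have t: "0 < t" "t \<le> 1" using x(2) mean_pos by (auto simp: t_def)
      have y: "portfolio y"
        unfolding y_def using t by (intro portfolio_convex_combination x e) auto
      have my: "\<mu> \<bullet> y = \<mu> \<bullet> b"
        using x(2) mean_pos e(2) by (simp add: y_def t_def inner_add_right)
      have "y \<bullet> (\<Sigma> *v y) = t\<^sup>2 * (x \<bullet> (\<Sigma> *v x))"
        by (simp add: y_def dilute)
      also have "\<dots> \<le> x \<bullet> (\<Sigma> *v x)"
        using t psd[of x] by (simp add: mult_left_le_one_le power_le_one)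
      also have "\<dots> < b \<bullet> (\<Sigma> *v b)" using less by simp
      \<comment> \<open>At equal means, a smaller \<open>K\<close> relaxes the constraint and raises
        the objective, so \<open>y\<close> beats \<open>b\<close>.\<close>
      finally have Ky: "K y < K b" by (simp add: K_def my)
      have "l * (l + 1) / 2 * K y \<le> l * (l + 1) / 2 * K b"
        using Ky l by (intro mult_left_mono) auto
      then have "- l * (\<mu> \<bullet> y) + l * (l + 1) / 2 * K y \<le> 0"
        using b(2) my by simp
      from best[OF y this] Ky my show False by simp
    qed
  qed
qed

section \<open>Moments of random vectors\<close>

text \<open>The components may themselves be vectors, so that two applications handle a matrix as a
  vector of rows.\<close>

lemma integrable_vec:
  fixes f :: "'a \<Rightarrow> 'b :: euclidean_space ^ 'n"
  assumes "\<And>i. integrable M (\<lambda>\<omega>. f \<omega> $ i)"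
  shows "integrable M f"
proof -
  have axis: "bounded_linear (axis i :: 'b \<Rightarrow> 'b ^ 'n)" for i
    by (auto simp: linear_conv_bounded_linear[symmetric] linear_iff vec_eq_iff axis_def)
  have "(\<lambda>\<omega>. \<Sum>i\<in>UNIV. axis i (f \<omega> $ i)) = f"
    by (auto simp: fun_eq_iff vec_eq_iff axis_def)
  moreover have "integrable M (\<lambda>\<omega>. \<Sum>i\<in>UNIV. axis i (f \<omega> $ i))"
    by (rule Bochner_Integration.integrable_sum) (rule integrable_bounded_linear[OF axis assms])
  ultimately show ?thesis by simp
qed

lemma integrable_mult_square_integrable:
  fixes f g :: "'a \<Rightarrow> real"
  assumes [measurable]: "f \<in> borel_measurable M" "g \<in> borel_measurable M"
    and "integrable M (\<lambda>x. (f x)\<^sup>2)" "integrable M (\<lambda>x. (g x)\<^sup>2)"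
  shows "integrable M (\<lambda>x. f x * g x)"
proof (rule Bochner_Integration.integrable_bound)
  show "integrable M (\<lambda>x. (f x)\<^sup>2 + (g x)\<^sup>2)"
    using assms by simp
  show "AE x in M. norm (f x * g x) \<le> norm ((f x)\<^sup>2 + (g x)\<^sup>2)"
  proof (rule AE_I2)
    fix x
    have "2 * \<bar>f x\<bar> * \<bar>g x\<bar> \<le> (f x)\<^sup>2 + (g x)\<^sup>2"
      using sum_squares_bound[of "\<bar>f x\<bar>" "\<bar>g x\<bar>"] by simp
    moreover have "0 \<le> \<bar>f x\<bar> * \<bar>g x\<bar>" by simp
    ultimately show "norm (f x * g x) \<le> norm ((f x)\<^sup>2 + (g x)\<^sup>2)"
      unfolding real_norm_def abs_mult by linarith
  qed
qed simp

lemma outer_product_quadratic_form: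
  "b \<bullet> (outer_product x x *v b) = (x \<bullet> b)\<^sup>2"
  by (simp add: outer_product_def matrix_vector_mult_def inner_vec_def power2_eq_square
      sum_product sum_distrib_left mult_ac)

lemma mean_return_inner:
  assumes "integrable M \<rho>"
  shows "(LINT \<omega>|M. \<rho> \<omega> \<bullet> b) = mean_return M \<rho> \<bullet> b"
  using assms by (simp add: mean_return_def)

text \<open>The map taking a matrix \<open>A\<close> to \<open>b \<bullet> (A *v b)\<close> is
  bounded linear, so it commutes with the integral of the outer product.\<close>

lemma integrable_square_inner:
  assumes "integrable M (\<lambda>\<omega>. outer_product (\<rho> \<omega>) (\<rho> \<omega>))"
  shows "integrable M (\<lambda>\<omega>. (\<rho> \<omega> \<bullet> b)\<^sup>2)"
    and "(LINT \<omega>|M. (\<rho> \<omega> \<bullet> b)\<^sup>2) =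
      b \<bullet> (covariance_matrix M \<rho> *v b) + (mean_return M \<rho> \<bullet> b)\<^sup>2"
proof -
  have T: "bounded_linear (\<lambda>A :: real ^ 'b ^ 'b. b \<bullet> (A *v b))"
    by (auto simp: linear_conv_bounded_linear[symmetric] linear_iff matrix_vector_mult_add_rdistrib
        scaleR_matrix_vector_assoc[symmetric] inner_add_right)
  show "integrable M (\<lambda>\<omega>. (\<rho> \<omega> \<bullet> b)\<^sup>2)"
    using integrable_bounded_linear[OF T assms] by (simp add: outer_product_quadratic_form)
  show "(LINT \<omega>|M. (\<rho> \<omega> \<bullet> b)\<^sup>2) =
      b \<bullet> (covariance_matrix M \<rho> *v b) + (mean_return M \<rho> \<bullet> b)\<^sup>2"
    using integral_bounded_linear[OF T assms]
    by (simp add: outer_product_quadratic_form covariance_matrix_def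
        matrix_vector_mult_diff_rdistrib inner_diff_right)
qed

text \<open>The form is the variance of the scalar return
  \<open>\<rho> \<omega> \<bullet> b\<close>.\<close>

lemma (in prob_space) covariance_matrix_nonneg:
  assumes \<rho>: "integrable M \<rho>"
    and \<rho>2: "integrable M (\<lambda>\<omega>. outer_product (\<rho> \<omega>) (\<rho> \<omega>))"
  shows "0 \<le> b \<bullet> (covariance_matrix M \<rho> *v b)"
proof -
  have "variance (\<lambda>\<omega>. \<rho> \<omega> \<bullet> b) = b \<bullet> (covariance_matrix M \<rho> *v b)"
    using integrable_square_inner[OF \<rho>2, of b] \<rho>
    by (subst variance_eq) (simp_all add: mean_return_def)
  then show ?thesis by (metis variance_positive)
qed

theorem mainTheorem3:
  fixes M :: "'a measure" and r \<rho> :: "'a \<Rightarrow> real ^ 'n" and k :: 'n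
    and \<mu> :: "real ^ 'n" and \<Sigma> :: "real ^ 'n ^ 'n" and l :: real
  assumes "prob_space M"
    and "r \<in> borel_measurable M"
    and "AE \<omega> in M. 0 \<le> r \<omega>"
    and "AE \<omega> in M. r \<omega> $ k = 1"
    and "\<And>i. integrable M (\<lambda>\<omega>. r \<omega> $ i)"
    and "\<And>i. integrable M (\<lambda>\<omega>. (r \<omega> $ i)\<^sup>2)"
    and "\<rho> = excess_return r"
    and "\<mu> = mean_return M \<rho>"
    and "\<Sigma> = covariance_matrix M \<rho>"
    and "l > 0"
    and "no_arbitrage \<mu> \<Sigma>"
  shows "\<forall>b. qrck_solution M \<rho> l b \<longrightarrow> markowitz_portfolio \<mu> \<Sigma> b"
proof (intro allI impI)
  fix b assume sol: "qrck_solution M \<rho> l b"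
  interpret prob_space M by fact
  have \<rho>_nth: "\<rho> \<omega> $ i = r \<omega> $ i - 1" for \<omega> i
    by (simp add: \<open>\<rho> = excess_return r\<close> excess_return_def)
  have int1: "integrable M (\<lambda>\<omega>. \<rho> \<omega> $ i)" for i
    by (simp add: \<rho>_nth assms(5))
  have int2: "integrable M (\<lambda>\<omega>. (\<rho> \<omega> $ i)\<^sup>2)" for i
    unfolding \<rho>_nth power2_diff using assms(5,6) by simp
  have \<rho>: "integrable M \<rho>"
    by (rule integrable_vec) (rule int1)
  have \<rho>2: "integrable M (\<lambda>\<omega>. outer_product (\<rho> \<omega>) (\<rho> \<omega>))"
    by (intro integrable_vec)
      (simp add: outer_product_def integrable_mult_square_integrable int1 int2
        borel_measurable_integrable)
  have mean: "(LINT \<omega>|M. \<rho> \<omega> \<bullet> c) = \<mu> \<bullet> c" for c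
    by (simp add: mean_return_inner[OF \<rho>] assms(8))
  have square: "(LINT \<omega>|M. (\<rho> \<omega> \<bullet> c)\<^sup>2) = c \<bullet> (\<Sigma> *v c) + (\<mu> \<bullet> c)\<^sup>2" for c
    by (simp add: integrable_square_inner(2)[OF \<rho>2] assms(8,9))
  let ?e = "axis k 1 :: real ^ 'n"
  have \<rho>_e: "AE \<omega> in M. \<rho> \<omega> \<bullet> ?e = 0"
    using assms(4) by eventually_elim (simp add: inner_axis \<rho>_nth)
  have \<mu>_e: "\<mu> \<bullet> ?e = 0"
    unfolding mean[symmetric] using \<rho>_e by (rule integral_eq_zero_AE)
  show "markowitz_portfolio \<mu> \<Sigma> b"
  proof (rule markowitz_portfolio_if_mean_variance_qrck_optimal[OF _ portfolio_axis \<mu>_e])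
    show "0 \<le> x \<bullet> (\<Sigma> *v x)" for x
      unfolding assms(9) using \<rho> \<rho>2 by (rule covariance_matrix_nonneg)
    show "(s *\<^sub>R c + t *\<^sub>R ?e) \<bullet> (\<Sigma> *v (s *\<^sub>R c + t *\<^sub>R ?e)) = s\<^sup>2 * (c \<bullet> (\<Sigma> *v c))" for s t c
    proof -
      \<comment> \<open>Almost surely the return of \<open>?x\<close> is \<open>s\<close> times that
        of \<open>c\<close>. Second moment and squared mean both scale by the square of
        \<open>s\<close>, hence so does the variance.\<close>
      let ?x = "s *\<^sub>R c + t *\<^sub>R ?e"
      have "(LINT \<omega>|M. (\<rho> \<omega> \<bullet> ?x)\<^sup>2) = (LINT \<omega>|M. s\<^sup>2 * (\<rho> \<omega> \<bullet> c)\<^sup>2)"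
      proof (rule integral_cong_AE)
        show "AE \<omega> in M. (\<rho> \<omega> \<bullet> ?x)\<^sup>2 = s\<^sup>2 * (\<rho> \<omega> \<bullet> c)\<^sup>2"
          using \<rho>_e by eventually_elim (simp add: inner_add_right power_mult_distrib)
      qed (use borel_measurable_integrable[OF integrable_square_inner(1)[OF \<rho>2]] in simp_all)
      then have "?x \<bullet> (\<Sigma> *v ?x) + (\<mu> \<bullet> ?x)\<^sup>2 = s\<^sup>2 * (c \<bullet> (\<Sigma> *v c) + (\<mu> \<bullet> c)\<^sup>2)"
        by (simp only: integral_mult_right_zero square)
      moreover have "\<mu> \<bullet> ?x = s * (\<mu> \<bullet> c)"
        using \<mu>_e by (simp add: inner_add_right)
      ultimately show ?thesis
        by (simp add: power_mult_distrib distrib_left)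
    qed
    show "is_arg_max (\<lambda>c. \<mu> \<bullet> c - 1 / 2 * (c \<bullet> (\<Sigma> *v c) + (\<mu> \<bullet> c)\<^sup>2))
      (\<lambda>c. portfolio c \<and>
        - l * (\<mu> \<bullet> c) + l * (l + 1) / 2 * (c \<bullet> (\<Sigma> *v c) + (\<mu> \<bullet> c)\<^sup>2) \<le> 0) b"
      using sol unfolding qrck_solution_def qrck_objective_def[abs_def] qrck_feasible_def[abs_def]
        mean square .
  qed fact+
qed

end
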